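(* Let $(M,H,G)$ be an almost $(H,G)$-manifold, $H=(J_1,J_2,J_3)$, $G=(g,g_1,g_2,g_3)$, let $\nabla$ be the Levi-Civita connection of $g$, and let $D$ be the linear connection $$D_yz=\nabla_yz+\frac14\sum_{\alpha=1}^3(\nabla_yJ_\alpha)J_\alpha z.$$ Then $D$ preserves the almost $(H,G)$-structure, i.e. $DJ_\alpha=Dg=Dg_\alpha=0$ for $\alpha=1,2,3$.
   Context: An almost $(H,G)$-manifold is a $4n$-dimensional smooth manifold $M$ with a triple $H=(J_1,J_2,J_3)$ of almost complex structures satisfying $J_\alpha=J_\beta\circ J_\gamma=-J_\gamma\circ J_\beta$, $J_\alpha^2=-I$ for all cyclic permutations $(\alpha,\beta,\gamma)$ of $(1,2,3)$, and a pseudo-Riemannian metric $g$ with $g(x,y)=\varepsilon_\alpha g(J_\alpha x,J_\alpha y)$, where $\varepsilon_1=1$, $\varepsilon_2=\varepsilon_3=-1$. $G=(g,g_1,g_2,g_3)$, where $g_\alpha(x,y)=g(J_\alpha x,y)=-\varepsilon_\alpha g(x,J_\alpha y)$. *)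

theory Defs
  imports "HOL-Analysis.Analysis" "HOL-Library.Function_Algebras"
begin

section \<open>Smooth manifolds\<close>

text \<open>Intended for open \<open>S\<close>.\<close>

primrec Ck_on :: "nat \<Rightarrow> 'e::euclidean_space set \<Rightarrow> ('e \<Rightarrow> 'f::real_normed_vector) \<Rightarrow> bool" where
  "Ck_on 0 S f \<longleftrightarrow> continuous_on S f"
| "Ck_on (Suc k) S f \<longleftrightarrow>
     (\<forall>x\<in>S. f differentiable (at x)) \<and> (\<forall>v. Ck_on k S (\<lambda>x. frechet_derivative f (at x) v))"

definition smooth_on :: "'e::euclidean_space set \<Rightarrow> ('e \<Rightarrow> 'f::real_normed_vector) \<Rightarrow> bool" where
  "smooth_on S f \<longleftrightarrow> (\<forall>k. Ck_on k S f)"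

type_synonym ('a, 'e) atlas = "('a set \<times> ('a \<Rightarrow> 'e)) set"

definition points :: "('a, 'e) atlas \<Rightarrow> 'a set" where
  "points A = (\<Union>(U, \<phi>)\<in>A. U)"

text \<open>The atlas need not be maximal; smoothness of functions is the same for the atlas and for the
  maximal atlas containing it.\<close>

definition smooth_manifold :: "'a topology \<Rightarrow> ('a, 'e::euclidean_space) atlas \<Rightarrow> bool" where
  "smooth_manifold T A \<longleftrightarrow>
     Hausdorff_space T \<and> second_countable T \<and> points A = topspace T \<and>
     (\<forall>(U, \<phi>)\<in>A. openin T U \<and> open (\<phi> ` U) \<and>
        homeomorphic_map (subtopology T U) (top_of_set (\<phi> ` U)) \<phi>) \<and>
     (\<forall>(U, \<phi>)\<in>A. \<forall>(V, \<psi>)\<in>A. smooth_on (\<phi> ` (U \<inter> V)) (\<psi> \<circ> inv_into U \<phi>))"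

text \<open>Real functions on the manifold are HOL functions whose values outside \<open>points A\<close> are
  irrelevant.\<close>

definition smooth_fun :: "('a, 'e::euclidean_space) atlas \<Rightarrow> ('a \<Rightarrow> real) \<Rightarrow> bool" where
  "smooth_fun A f \<longleftrightarrow> (\<forall>(U, \<phi>)\<in>A. smooth_on (\<phi> ` U) (f \<circ> inv_into U \<phi>))"

section \<open>Tangent vectors and vector fields\<close>

text \<open>A tangent vector at \<open>p\<close> is a derivation at \<open>p\<close> of the algebra of smooth functions. It is set
  to \<open>0\<close> on functions that are not smooth, so that equality of tangent vectors is equality of HOL
  functions. The zero, sums, differences and products of functions are the pointwise ones.\<close>

type_synonym 'a tvec = "('a \<Rightarrow> real) \<Rightarrow> real"
type_synonym 'a vfield = "'a \<Rightarrow> 'a tvec"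

definition tangent_space :: "('a, 'e::euclidean_space) atlas \<Rightarrow> 'a \<Rightarrow> 'a tvec set" where
  "tangent_space A p = {v.
     (\<forall>f h. smooth_fun A f \<longrightarrow> smooth_fun A h \<longrightarrow> v (f + h) = v f + v h) \<and>
     (\<forall>c f. smooth_fun A f \<longrightarrow> v (\<lambda>q. c * f q) = c * v f) \<and>
     (\<forall>f h. smooth_fun A f \<longrightarrow> smooth_fun A h \<longrightarrow> v (f * h) = f p * v h + h p * v f) \<and>
     (\<forall>f. \<not> smooth_fun A f \<longrightarrow> v f = 0)}"

definition tscale :: "real \<Rightarrow> 'a tvec \<Rightarrow> 'a tvec" where
  "tscale c v = (\<lambda>f. c * v f)"

text \<open>Vector fields vanish outside \<open>points A\<close>, so that equality of vector fields is equality of HOL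
  functions.\<close>

definition vector_fields :: "('a, 'e::euclidean_space) atlas \<Rightarrow> 'a vfield set" where
  "vector_fields A = {X.
     (\<forall>p\<in>points A. X p \<in> tangent_space A p) \<and>
     (\<forall>p. p \<notin> points A \<longrightarrow> X p = 0) \<and>
     (\<forall>f. smooth_fun A f \<longrightarrow> smooth_fun A (\<lambda>p. X p f))}"

definition fscale :: "('a \<Rightarrow> real) \<Rightarrow> 'a vfield \<Rightarrow> 'a vfield" where
  "fscale u X = (\<lambda>p. tscale (u p) (X p))"

definition deriv_along :: "'a vfield \<Rightarrow> ('a \<Rightarrow> real) \<Rightarrow> 'a \<Rightarrow> real" where
  "deriv_along X f = (\<lambda>p. X p f)"

definition lie_bracket :: "'a vfield \<Rightarrow> 'a vfield \<Rightarrow> 'a vfield" where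
  "lie_bracket X Y = (\<lambda>p f. X p (deriv_along Y f) - Y p (deriv_along X f))"

text \<open>Tangent vectors do not see the values of a function outside the manifold.\<close>

lemma Ck_on_cong:
  fixes f h :: "'e::euclidean_space \<Rightarrow> 'f::real_normed_vector"
  assumes "open S" "\<And>x. x \<in> S \<Longrightarrow> f x = h x"
  shows "Ck_on k S f \<longleftrightarrow> Ck_on k S h"
  using assms(2)
proof (induction k arbitrary: f h)
  case 0
  then show ?case by (simp cong: continuous_on_cong)
next
  case (Suc k)
  have der: "(f has_derivative D) (at x) \<longleftrightarrow> (h has_derivative D) (at x)" if "x \<in> S" for x D
    using has_derivative_transform_within_open[of f D x UNIV S h]
      has_derivative_transform_within_open[of h D x UNIV S f] Suc.prems assms(1) that by auto
  have "frechet_derivative f (at x) = frechet_derivative h (at x)" if "x \<in> S" for x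
    unfolding frechet_derivative_def using der[OF that] by simp
  then have "Ck_on k S (\<lambda>x. frechet_derivative f (at x) v) \<longleftrightarrow>
      Ck_on k S (\<lambda>x. frechet_derivative h (at x) v)" for v
    by (intro Suc.IH) simp
  then show ?case
    using der unfolding Ck_on.simps differentiable_def by blast
qed

lemma smooth_fun_cong:
  assumes "smooth_manifold T A" "\<And>q. q \<in> points A \<Longrightarrow> f q = h q"
  shows "smooth_fun A f \<longleftrightarrow> smooth_fun A h"
proof -
  have "smooth_on (\<phi> ` U) (f \<circ> inv_into U \<phi>) \<longleftrightarrow> smooth_on (\<phi> ` U) (h \<circ> inv_into U \<phi>)"
    if "(U, \<phi>) \<in> A" for U \<phi>
  proof -
    have "open (\<phi> ` U)" using assms(1) that unfolding smooth_manifold_def by auto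
    moreover have "U \<subseteq> points A" using that unfolding points_def by auto
    ultimately show ?thesis
      unfolding smooth_on_def
      by (intro all_cong1 Ck_on_cong) (auto intro!: assms(2) inv_into_into)
  qed
  then show ?thesis unfolding smooth_fun_def by blast
qed

lemma Ck_on_const: "Ck_on k S (\<lambda>_. c)"
  by (induction k arbitrary: c) auto

lemma smooth_fun_const: "smooth_fun A (\<lambda>_. c)"
  unfolding smooth_fun_def smooth_on_def comp_def by (auto simp: Ck_on_const)

lemma tangent_cong:
  assumes M: "smooth_manifold T A" and p: "p \<in> points A" and v: "v \<in> tangent_space A p"
    and eq: "\<And>q. q \<in> points A \<Longrightarrow> f q = h q"
  shows "v f = v h"
proof (cases "smooth_fun A f")
  case True
  define k :: "'a \<Rightarrow> real" where "k = (\<lambda>q. if q \<in> points A then 1 else 0)"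
  have h: "smooth_fun A h" using smooth_fun_cong[OF M, of f h] eq True by blast
  have k: "smooth_fun A k"
    using smooth_fun_cong[OF M, of k "\<lambda>_. 1"] smooth_fun_const by (auto simp: k_def)
  have leib: "v (a * b) = a p * v b + b p * v a" if "smooth_fun A a" "smooth_fun A b" for a b
    using v that unfolding tangent_space_def by blast
  have "k * k = k" "k p = 1" using p by (auto simp: k_def)
  then have "v k = 0" using leib[OF k k] by simp
  then have "v (k * f) = v f" "v (k * h) = v h"
    using leib[OF k True] leib[OF k h] \<open>k p = 1\<close> by simp_all
  moreover have "k * f = k * h" using eq by (auto simp: k_def)
  ultimately show ?thesis by simp
next
  case False
  then have "\<not> smooth_fun A h" using smooth_fun_cong[OF M, of f h] eq by blast
  with False show ?thesis using v unfolding tangent_space_def by auto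
qed

section \<open>Tensor fields and connections\<close>

type_synonym 'a endo_field = "'a \<Rightarrow> 'a tvec \<Rightarrow> 'a tvec"
type_synonym 'a bilin_field = "'a \<Rightarrow> 'a tvec \<Rightarrow> 'a tvec \<Rightarrow> real"
type_synonym 'a connection = "'a vfield \<Rightarrow> 'a vfield \<Rightarrow> 'a vfield"

definition endo_app ::
    "('a, 'e::euclidean_space) atlas \<Rightarrow> 'a endo_field \<Rightarrow> 'a vfield \<Rightarrow> 'a vfield" where
  "endo_app A J X = (\<lambda>p. if p \<in> points A then J p (X p) else 0)"

definition bilin_app :: "'a bilin_field \<Rightarrow> 'a vfield \<Rightarrow> 'a vfield \<Rightarrow> 'a \<Rightarrow> real" where
  "bilin_app b X Y = (\<lambda>p. b p (X p) (Y p))"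

definition smooth_endo_field ::
    "('a, 'e::euclidean_space) atlas \<Rightarrow> 'a endo_field \<Rightarrow> bool" where
  "smooth_endo_field A J \<longleftrightarrow>
     (\<forall>p\<in>points A. \<forall>v\<in>tangent_space A p. \<forall>w\<in>tangent_space A p. \<forall>c.
        J p v \<in> tangent_space A p \<and> J p (v + w) = J p v + J p w \<and>
        J p (tscale c v) = tscale c (J p v)) \<and>
     (\<forall>X\<in>vector_fields A. endo_app A J X \<in> vector_fields A)"

definition smooth_bilin_field ::
    "('a, 'e::euclidean_space) atlas \<Rightarrow> 'a bilin_field \<Rightarrow> bool" where
  "smooth_bilin_field A b \<longleftrightarrow>
     (\<forall>p\<in>points A. \<forall>u\<in>tangent_space A p. \<forall>v\<in>tangent_space A p. \<forall>w\<in>tangent_space A p. \<forall>c.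
        b p (u + v) w = b p u w + b p v w \<and> b p (tscale c u) w = c * b p u w \<and>
        b p w (u + v) = b p w u + b p w v \<and> b p w (tscale c u) = c * b p w u) \<and>
     (\<forall>X\<in>vector_fields A. \<forall>Y\<in>vector_fields A. smooth_fun A (bilin_app b X Y))"

definition almost_complex_structure ::
    "('a, 'e::euclidean_space) atlas \<Rightarrow> 'a endo_field \<Rightarrow> bool" where
  "almost_complex_structure A J \<longleftrightarrow>
     smooth_endo_field A J \<and> (\<forall>p\<in>points A. \<forall>v\<in>tangent_space A p. J p (J p v) = - v)"

definition pseudo_riemannian_metric ::
    "('a, 'e::euclidean_space) atlas \<Rightarrow> 'a bilin_field \<Rightarrow> bool" where
  "pseudo_riemannian_metric A g \<longleftrightarrow>
     smooth_bilin_field A g \<and>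
     (\<forall>p\<in>points A. \<forall>v\<in>tangent_space A p. \<forall>w\<in>tangent_space A p. g p v w = g p w v) \<and>
     (\<forall>p\<in>points A. \<forall>v\<in>tangent_space A p. (\<forall>w\<in>tangent_space A p. g p v w = 0) \<longrightarrow> v = 0)"

definition linear_connection ::
    "('a, 'e::euclidean_space) atlas \<Rightarrow> 'a connection \<Rightarrow> bool" where
  "linear_connection A D \<longleftrightarrow>
     (\<forall>X\<in>vector_fields A. \<forall>Y\<in>vector_fields A. \<forall>Z\<in>vector_fields A. \<forall>u. smooth_fun A u \<longrightarrow>
        D X Y \<in> vector_fields A \<and>
        D (X + Y) Z = D X Z + D Y Z \<and>
        D (fscale u X) Y = fscale u (D X Y) \<and>
        D X (Y + Z) = D X Y + D X Z \<and>
        D X (fscale u Y) = fscale (deriv_along X u) Y + fscale u (D X Y))"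

text \<open>The derivatives of tensor fields induced by a connection, evaluated at vector fields:
  \<open>(D_Y J) Z\<close> and \<open>(D_Y b)(X, Z)\<close>.\<close>

definition cov_deriv_endo ::
    "('a, 'e::euclidean_space) atlas \<Rightarrow> 'a connection \<Rightarrow> 'a endo_field \<Rightarrow>
      'a vfield \<Rightarrow> 'a vfield \<Rightarrow> 'a vfield" where
  "cov_deriv_endo A D J Y Z = D Y (endo_app A J Z) - endo_app A J (D Y Z)"

definition cov_deriv_bilin ::
    "'a connection \<Rightarrow> 'a bilin_field \<Rightarrow> 'a vfield \<Rightarrow> 'a vfield \<Rightarrow> 'a vfield \<Rightarrow> 'a \<Rightarrow> real" where
  "cov_deriv_bilin D b Y X Z =
     deriv_along Y (bilin_app b X Z) - bilin_app b (D Y X) Z - bilin_app b X (D Y Z)"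

definition parallel_endo ::
    "('a, 'e::euclidean_space) atlas \<Rightarrow> 'a connection \<Rightarrow> 'a endo_field \<Rightarrow> bool" where
  "parallel_endo A D J \<longleftrightarrow>
     (\<forall>Y\<in>vector_fields A. \<forall>Z\<in>vector_fields A. cov_deriv_endo A D J Y Z = 0)"

definition parallel_bilin ::
    "('a, 'e::euclidean_space) atlas \<Rightarrow> 'a connection \<Rightarrow> 'a bilin_field \<Rightarrow> bool" where
  "parallel_bilin A D b \<longleftrightarrow>
     (\<forall>Y\<in>vector_fields A. \<forall>X\<in>vector_fields A. \<forall>Z\<in>vector_fields A.
        \<forall>p\<in>points A. cov_deriv_bilin D b Y X Z p = 0)"

definition levi_civita_connection ::
    "('a, 'e::euclidean_space) atlas \<Rightarrow> 'a bilin_field \<Rightarrow> 'a connection \<Rightarrow> bool" where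
  "levi_civita_connection A g D \<longleftrightarrow>
     linear_connection A D \<and> parallel_bilin A D g \<and>
     (\<forall>X\<in>vector_fields A. \<forall>Y\<in>vector_fields A. D X Y - D Y X = lie_bracket X Y)"

section \<open>Almost (H,G)-manifolds\<close>

text \<open>The triple \<open>H\<close> is a family \<open>J\<close> indexed by \<open>1, 2, 3\<close>; its other values are irrelevant. The
  forms \<open>g_1, g_2, g_3\<close> of \<open>G\<close> are determined by \<open>g\<close> and \<open>J\<close>.\<close>

definition eps :: "nat \<Rightarrow> real" where
  "eps \<alpha> = (if \<alpha> = 1 then 1 else - 1)"

definition almost_HG_manifold ::
    "nat \<Rightarrow> 'a topology \<Rightarrow> ('a, 'e::euclidean_space) atlas \<Rightarrow> (nat \<Rightarrow> 'a endo_field) \<Rightarrow>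
      'a bilin_field \<Rightarrow> bool" where
  "almost_HG_manifold n T A J g \<longleftrightarrow>
     smooth_manifold T A \<and> DIM('e) = 4 * n \<and>
     (\<forall>\<alpha>\<in>{1, 2, 3}. almost_complex_structure A (J \<alpha>)) \<and>
     (\<forall>(\<alpha>, \<beta>, \<gamma>)\<in>{(1, 2, 3), (2, 3, 1), (3, 1, 2)}. \<forall>p\<in>points A. \<forall>v\<in>tangent_space A p.
        J \<alpha> p v = J \<beta> p (J \<gamma> p v) \<and> J \<alpha> p v = - J \<gamma> p (J \<beta> p v)) \<and>
     pseudo_riemannian_metric A g \<and>
     (\<forall>\<alpha>\<in>{1, 2, 3}. \<forall>p\<in>points A. \<forall>v\<in>tangent_space A p. \<forall>w\<in>tangent_space A p.
        g p v w = eps \<alpha> * g p (J \<alpha> p v) (J \<alpha> p w))"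

definition assoc_form :: "'a bilin_field \<Rightarrow> 'a endo_field \<Rightarrow> 'a bilin_field" where
  "assoc_form g J = (\<lambda>p v w. g p (J p v) w)"

definition HG_connection ::
    "('a, 'e::euclidean_space) atlas \<Rightarrow> (nat \<Rightarrow> 'a endo_field) \<Rightarrow> 'a connection \<Rightarrow>
      'a connection" where
  "HG_connection A J nabla Y Z =
     nabla Y Z + fscale (\<lambda>_. 1 / 4) (\<Sum>\<alpha>\<in>{1, 2, 3}. cov_deriv_endo A nabla (J \<alpha>) Y (endo_app A (J \<alpha>) Z))"

end

theory Submission
  imports Defs
begin

text \<open>Since \<open>J\<^sub>\<alpha>\<^sup>2 = -I\<close>, the connection
  \<open>D\<^sub>y z = (\<nabla>\<^sub>y z - (\<Sum>\<alpha>. J\<^sub>\<alpha> (\<nabla>\<^sub>y (J\<^sub>\<alpha> z)))) / 4\<close> is the average of the conjugates of \<open>\<nabla>\<close> by \<open>I, J\<^sub>1, J\<^sub>2, J\<^sub>3\<close>.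
  Composition with \<open>J\<^sub>\<beta>\<close> permutes these four structures up to sign, so \<open>D\<close> commutes with
  \<open>J\<^sub>\<beta>\<close>. As \<open>J\<^sub>\<alpha>\<close> is an isometry or anti-isometry of \<open>g\<close>, each conjugate
  of \<open>\<nabla>\<close> is again metric, and hence so is the average.\<close>

section \<open>Sums and constant multiples of smooth functions and vector fields\<close>

text \<open>Induction on the order. The derivative of the sum is the sum of the derivatives only at
  points of \<open>S\<close>, so the induction hypothesis is transferred by
  \<open>Ck_on_cong\<close>, which relies on \<open>S\<close> being open.\<close>

lemma Ck_on_add:
  fixes f h :: "'e::euclidean_space \<Rightarrow> 'f::real_normed_vector"
  assumes S: "open S" and "Ck_on k S f" "Ck_on k S h"
  shows "Ck_on k S (\<lambda>x. f x + h x)"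
  using assms(2,3)
proof (induction k arbitrary: f h)
  case 0
  then show ?case by (simp add: continuous_on_add)
next
  case (Suc k)
  have "Ck_on k S (\<lambda>x. frechet_derivative (\<lambda>x. f x + h x) (at x) v)" for v
  proof -
    have "Ck_on k S (\<lambda>x. frechet_derivative f (at x) v + frechet_derivative h (at x) v)"
      using Suc by simp
    moreover have "frechet_derivative (\<lambda>x. f x + h x) (at x) v =
        frechet_derivative f (at x) v + frechet_derivative h (at x) v" if "x \<in> S" for x
      using Suc.prems that by (auto simp: frechet_derivative_works
          intro!: fun_cong[OF frechet_derivative_at[symmetric]] has_derivative_add)
    ultimately show ?thesis
      using Ck_on_cong[OF S] by (metis (mono_tags, lifting))
  qed
  then show ?case using Suc.prems by simp
qed

lemma Ck_on_cmult:
  fixes f :: "'e::euclidean_space \<Rightarrow> real"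
  assumes S: "open S" and "Ck_on k S f"
  shows "Ck_on k S (\<lambda>x. c * f x)"
  using assms(2)
proof (induction k arbitrary: f)
  case 0
  then show ?case by (simp add: continuous_on_mult_left)
next
  case (Suc k)
  have "Ck_on k S (\<lambda>x. frechet_derivative (\<lambda>x. c * f x) (at x) v)" for v
  proof -
    have "Ck_on k S (\<lambda>x. c * frechet_derivative f (at x) v)"
      using Suc by simp
    moreover have "frechet_derivative (\<lambda>x. c * f x) (at x) v =
        c * frechet_derivative f (at x) v" if "x \<in> S" for x
      using Suc.prems that by (auto simp: frechet_derivative_works
          intro!: fun_cong[OF frechet_derivative_at[symmetric]] has_derivative_mult_right)
    ultimately show ?thesis
      using Ck_on_cong[OF S] by (metis (mono_tags, lifting))
  qed
  then show ?case using Suc.prems by simp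
qed

lemma smooth_fun_add:
  assumes "smooth_manifold T A" "smooth_fun A f" "smooth_fun A h"
  shows "smooth_fun A (\<lambda>p. f p + h p)"
  unfolding smooth_fun_def smooth_on_def comp_def
proof clarify
  fix U \<phi> k assume "(U, \<phi>) \<in> A"
  then show "Ck_on k (\<phi> ` U) (\<lambda>x. f (inv_into U \<phi> x) + h (inv_into U \<phi> x))"
    using assms unfolding smooth_manifold_def smooth_fun_def smooth_on_def comp_def
    by (intro Ck_on_add) blast+
qed

lemma smooth_fun_cmult:
  assumes "smooth_manifold T A" "smooth_fun A f"
  shows "smooth_fun A (\<lambda>p. c * f p)"
  unfolding smooth_fun_def smooth_on_def comp_def
proof clarify
  fix U \<phi> k assume "(U, \<phi>) \<in> A"
  then show "Ck_on k (\<phi> ` U) (\<lambda>x. c * f (inv_into U \<phi> x))"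
    using assms unfolding smooth_manifold_def smooth_fun_def smooth_on_def comp_def
    by (intro Ck_on_cmult) blast+
qed

lemma tangent_space_add:
  assumes "v \<in> tangent_space A p" "w \<in> tangent_space A p"
  shows "v + w \<in> tangent_space A p"
  using assms unfolding tangent_space_def by (auto simp: algebra_simps)

lemma tangent_space_tscale:
  assumes "v \<in> tangent_space A p"
  shows "tscale c v \<in> tangent_space A p"
  using assms unfolding tangent_space_def tscale_def by (auto simp: algebra_simps)

text \<open>Treating negation as a scaling makes the negation rules for fields, endomorphisms and
  bilinear forms instances of the scaling rules.\<close>

lemma uminus_eq_fscale: "- X = fscale (\<lambda>_. - 1) X"
  by (simp add: fscale_def tscale_def fun_eq_iff)

lemma fscale_add: "fscale u (X + Y) = fscale u X + fscale u Y"
  by (simp add: fscale_def tscale_def fun_eq_iff algebra_simps)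

lemma fscale_diff: "fscale u (X - Y) = fscale u X - fscale u Y"
  by (simp add: fscale_def tscale_def fun_eq_iff algebra_simps)

lemma fscale_commute: "fscale u (fscale w X) = fscale w (fscale u X)"
  by (simp add: fscale_def tscale_def fun_eq_iff)

lemma vector_fields_add:
  assumes "smooth_manifold T A" "X \<in> vector_fields A" "Y \<in> vector_fields A"
  shows "X + Y \<in> vector_fields A"
  using assms unfolding vector_fields_def by (auto intro: tangent_space_add smooth_fun_add)

lemma vector_fields_fscale_const:
  assumes "smooth_manifold T A" "X \<in> vector_fields A"
  shows "fscale (\<lambda>_. c) X \<in> vector_fields A"
proof -
  have "smooth_fun A (\<lambda>p. fscale (\<lambda>_. c) X p f)" if "smooth_fun A f" for f
    using assms that smooth_fun_cmult unfolding vector_fields_def fscale_def tscale_def by blast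
  moreover have "fscale (\<lambda>_. c) X p = 0" if "p \<notin> points A" for p
    using assms that by (simp add: vector_fields_def fscale_def tscale_def fun_eq_iff)
  ultimately show ?thesis
    using assms by (simp add: vector_fields_def) (simp add: fscale_def tangent_space_tscale)
qed

lemma vector_fields_uminus:
  assumes "smooth_manifold T A" "X \<in> vector_fields A"
  shows "- X \<in> vector_fields A"
  using assms by (simp add: uminus_eq_fscale vector_fields_fscale_const)

lemma vector_fields_diff:
  assumes "smooth_manifold T A" "X \<in> vector_fields A" "Y \<in> vector_fields A"
  shows "X - Y \<in> vector_fields A"
  using vector_fields_add[OF assms(1,2) vector_fields_uminus[OF assms(1,3)]] by simp

text \<open>Vector fields without the smoothness condition: unlike \<open>vector_fields\<close>, these are closed under
  multiplication by functions for trivial reasons, and tensor fields still act linearly on them.\<close>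

definition rough_fields :: "('a, 'e::euclidean_space) atlas \<Rightarrow> 'a vfield set" where
  "rough_fields A =
     {X. (\<forall>p\<in>points A. X p \<in> tangent_space A p) \<and> (\<forall>p. p \<notin> points A \<longrightarrow> X p = 0)}"

lemma vector_field_rough: "X \<in> vector_fields A \<Longrightarrow> X \<in> rough_fields A"
  by (simp add: vector_fields_def rough_fields_def)

lemma rough_field_tangent: "X \<in> rough_fields A \<Longrightarrow> p \<in> points A \<Longrightarrow> X p \<in> tangent_space A p"
  by (simp add: rough_fields_def)

lemma rough_fields_add: "X \<in> rough_fields A \<Longrightarrow> Y \<in> rough_fields A \<Longrightarrow> X + Y \<in> rough_fields A"
  by (simp add: rough_fields_def tangent_space_add)

lemma rough_fields_fscale: "X \<in> rough_fields A \<Longrightarrow> fscale u X \<in> rough_fields A"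
  by (simp add: rough_fields_def fscale_def tangent_space_tscale) (simp add: tscale_def fun_eq_iff)

lemma rough_fields_uminus: "X \<in> rough_fields A \<Longrightarrow> - X \<in> rough_fields A"
  by (simp add: uminus_eq_fscale rough_fields_fscale)

lemma rough_fields_diff: "X \<in> rough_fields A \<Longrightarrow> Y \<in> rough_fields A \<Longrightarrow> X - Y \<in> rough_fields A"
  using rough_fields_add[OF _ rough_fields_uminus] by fastforce

section \<open>Endomorphism fields and bilinear forms acting on fields\<close>

lemma rough_fields_endo_app:
  assumes "smooth_endo_field A F" "X \<in> rough_fields A"
  shows "endo_app A F X \<in> rough_fields A"
  using assms unfolding rough_fields_def smooth_endo_field_def endo_app_def by auto

lemma endo_app_vector_field:
  assumes "smooth_endo_field A F" "X \<in> vector_fields A"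
  shows "endo_app A F X \<in> vector_fields A"
  using assms unfolding smooth_endo_field_def by blast

lemma endo_app_add:
  assumes "smooth_endo_field A F" "X \<in> rough_fields A" "Y \<in> rough_fields A"
  shows "endo_app A F (X + Y) = endo_app A F X + endo_app A F Y"
  using assms unfolding rough_fields_def smooth_endo_field_def endo_app_def
  by (intro ext) simp

lemma endo_app_fscale:
  assumes "smooth_endo_field A F" "X \<in> rough_fields A"
  shows "endo_app A F (fscale u X) = fscale u (endo_app A F X)"
proof (rule ext)
  fix p
  have "F p (tscale c v) = tscale c (F p v)" if "p \<in> points A" "v \<in> tangent_space A p" for c v
    using assms that unfolding smooth_endo_field_def by blast
  \<comment> \<open>This covers \<open>p\<close> outside the manifold, where \<open>endo_app\<close>
    takes its default value 0.\<close>
  moreover have "tscale c 0 = (0 :: 'a tvec)" for c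
    by (simp add: tscale_def fun_eq_iff)
  ultimately show "endo_app A F (fscale u X) p = fscale u (endo_app A F X) p"
    using assms(2) by (simp add: endo_app_def fscale_def rough_fields_def)
qed

lemma endo_app_uminus:
  assumes "smooth_endo_field A F" "X \<in> rough_fields A"
  shows "endo_app A F (- X) = - endo_app A F X"
  using endo_app_fscale[OF assms] by (simp add: uminus_eq_fscale)

lemma endo_app_diff:
  assumes "smooth_endo_field A F" "X \<in> rough_fields A" "Y \<in> rough_fields A"
  shows "endo_app A F (X - Y) = endo_app A F X - endo_app A F Y"
  using endo_app_add[OF assms(1,2) rough_fields_uminus[OF assms(3)]]
    endo_app_uminus[OF assms(1,3)] by simp

lemma bilin_app_add:
  assumes "smooth_bilin_field A b" "X \<in> rough_fields A" "Y \<in> rough_fields A" "Z \<in> rough_fields A"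
    "p \<in> points A"
  shows "bilin_app b (X + Y) Z p = bilin_app b X Z p + bilin_app b Y Z p"
    and "bilin_app b Z (X + Y) p = bilin_app b Z X p + bilin_app b Z Y p"
  using assms unfolding rough_fields_def smooth_bilin_field_def bilin_app_def by simp_all

lemma bilin_app_fscale:
  assumes "smooth_bilin_field A b" "X \<in> rough_fields A" "Z \<in> rough_fields A" "p \<in> points A"
  shows "bilin_app b (fscale u X) Z p = u p * bilin_app b X Z p"
    and "bilin_app b Z (fscale u X) p = u p * bilin_app b Z X p"
  using assms unfolding rough_fields_def smooth_bilin_field_def bilin_app_def fscale_def
  by (blast, blast)

lemma bilin_app_uminus:
  assumes "smooth_bilin_field A b" "X \<in> rough_fields A" "Z \<in> rough_fields A" "p \<in> points A"
  shows "bilin_app b (- X) Z p = - bilin_app b X Z p"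
    and "bilin_app b Z (- X) p = - bilin_app b Z X p"
  using bilin_app_fscale[OF assms] by (simp_all add: uminus_eq_fscale)

lemma bilin_app_diff:
  assumes "smooth_bilin_field A b" "X \<in> rough_fields A" "Y \<in> rough_fields A" "Z \<in> rough_fields A"
    "p \<in> points A"
  shows "bilin_app b (X - Y) Z p = bilin_app b X Z p - bilin_app b Y Z p"
    and "bilin_app b Z (X - Y) p = bilin_app b Z X p - bilin_app b Z Y p"
  using bilin_app_add[OF assms(1,2) rough_fields_uminus[OF assms(3)] assms(4,5)]
    bilin_app_uminus[OF assms(1,3,4,5)] by simp_all

section \<open>Directional derivatives and general connections\<close>

text \<open>The identities for \<open>g\<close> and \<open>J\<close> hold only at points of the
  manifold; this allows them to be differentiated although the two functions may differ
  elsewhere.\<close>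

lemma deriv_along_cong:
  assumes "smooth_manifold T A" "Y \<in> vector_fields A" "p \<in> points A"
    and "\<And>q. q \<in> points A \<Longrightarrow> f q = h q"
  shows "deriv_along Y f p = deriv_along Y h p"
proof -
  have "Y p \<in> tangent_space A p" using assms(2,3) by (simp add: vector_fields_def)
  then show ?thesis unfolding deriv_along_def by (rule tangent_cong[OF assms(1,3) _ assms(4)])
qed

lemma deriv_along_cmult:
  assumes "Y \<in> vector_fields A" "p \<in> points A" "smooth_fun A f"
  shows "deriv_along Y (\<lambda>q. c * f q) p = c * deriv_along Y f p"
  using assms unfolding deriv_along_def vector_fields_def tangent_space_def by blast

text \<open>Additivity alone suffices; the Leibniz rule for the factor -1 would first require that
  constants have derivative 0.\<close>

lemma linear_connection_uminus:
  assumes M: "smooth_manifold T A" and N: "linear_connection A N"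
    and X: "X \<in> vector_fields A" and Y: "Y \<in> vector_fields A"
  shows "N X (- Y) = - N X Y"
proof -
  \<comment> \<open>The clauses of \<open>linear_connection\<close> share the premise that
    \<open>u\<close> is smooth, so a constant function serves as \<open>u\<close>.\<close>
  have add: "N X (Z + W) = N X Z + N X W" if "Z \<in> vector_fields A" "W \<in> vector_fields A" for Z W
    using N X that smooth_fun_const unfolding linear_connection_def by blast
  have Y': "- Y \<in> vector_fields A" using vector_fields_uminus[OF M Y] .
  have 0: "0 \<in> vector_fields A" using vector_fields_add[OF M Y Y'] by simp
  have "N X 0 = 0" using add[OF 0 0] by simp
  then show ?thesis using add[OF Y Y'] by (simp add: eq_neg_iff_add_eq_0 add.commute)
qed

section \<open>The quaternionic relations on fields\<close>

locale almost_HG_connection =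
  fixes n :: nat
    and T :: "'a topology"
    and A :: "('a, 'e::euclidean_space) atlas"
    and J :: "nat \<Rightarrow> 'a endo_field"
    and g :: "'a bilin_field"
    and nabla :: "'a connection"
  assumes HG: "almost_HG_manifold n T A J g"
    and LC: "levi_civita_connection A g nabla"
begin

abbreviation V where "V \<equiv> vector_fields A"
abbreviation R where "R \<equiv> rough_fields A"
abbreviation K where "K \<alpha> \<equiv> endo_app A (J \<alpha>)"
abbreviation D where "D \<equiv> HG_connection A J nabla"

text \<open>Closed under rotation, so a computation for a generic triple has all products of the
  three structures at hand and covers every index.\<close>

definition cyclic_triples :: "(nat \<times> nat \<times> nat) set" where
  "cyclic_triples = {(1, 2, 3), (2, 3, 1), (3, 1, 2)}"

lemma rotate: "(\<alpha>, \<beta>, \<gamma>) \<in> cyclic_triples \<Longrightarrow> (\<beta>, \<gamma>, \<alpha>) \<in> cyclic_triples"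
  by (auto simp: cyclic_triples_def)

lemma cyclic_mem: "(\<alpha>, \<beta>, \<gamma>) \<in> cyclic_triples \<Longrightarrow> \<alpha> \<in> {1, 2, 3}"
  by (auto simp: cyclic_triples_def)

lemma manifold: "smooth_manifold T A"
  using HG by (simp add: almost_HG_manifold_def)

lemma J_smooth: "\<alpha> \<in> {1, 2, 3} \<Longrightarrow> smooth_endo_field A (J \<alpha>)"
  using HG unfolding almost_HG_manifold_def almost_complex_structure_def by blast

lemma J_square: "\<alpha> \<in> {1, 2, 3} \<Longrightarrow> p \<in> points A \<Longrightarrow> v \<in> tangent_space A p \<Longrightarrow> J \<alpha> p (J \<alpha> p v) = - v"
  using HG unfolding almost_HG_manifold_def almost_complex_structure_def by blast

lemma g_smooth: "smooth_bilin_field A g"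
  using HG by (simp add: almost_HG_manifold_def pseudo_riemannian_metric_def)

lemma nabla_connection: "linear_connection A nabla"
  using LC by (simp add: levi_civita_connection_def)

lemmas K_V = endo_app_vector_field[OF J_smooth]
lemmas K_R = rough_fields_endo_app[OF J_smooth]
lemmas K_linear = endo_app_add[OF J_smooth] endo_app_diff[OF J_smooth] endo_app_uminus[OF J_smooth]
  endo_app_fscale[OF J_smooth]
lemmas V_closed = vector_fields_add[OF manifold] vector_fields_diff[OF manifold]
  vector_fields_uminus[OF manifold] vector_fields_fscale_const[OF manifold] K_V
lemmas R_closed = vector_field_rough rough_fields_add rough_fields_diff rough_fields_uminus
  rough_fields_fscale K_R

lemma
  assumes "X \<in> V" "Y \<in> V"
  shows nabla_V: "nabla X Y \<in> V"
    and nabla_add_left: "Z \<in> V \<Longrightarrow> nabla (X + Y) Z = nabla X Z + nabla Y Z"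
    and nabla_fscale_left: "smooth_fun A u \<Longrightarrow> nabla (fscale u X) Y = fscale u (nabla X Y)"
    and nabla_add_right: "Z \<in> V \<Longrightarrow> nabla X (Y + Z) = nabla X Y + nabla X Z"
    and nabla_fscale_right: "smooth_fun A u \<Longrightarrow>
      nabla X (fscale u Y) = fscale (deriv_along X u) Y + fscale u (nabla X Y)"
    and nabla_uminus: "nabla X (- Y) = - nabla X Y"
  using nabla_connection assms smooth_fun_const linear_connection_uminus[OF manifold]
  unfolding linear_connection_def by blast+

lemma K_square: "\<alpha> \<in> {1, 2, 3} \<Longrightarrow> X \<in> R \<Longrightarrow> K \<alpha> (K \<alpha> X) = - X"
  by (rule ext) (simp only: endo_app_def rough_fields_def mem_Collect_eq J_square if_True if_False
      fun_Compl_def split: if_splits, auto simp: J_square)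

lemma K_cyclic:
  assumes "(\<alpha>, \<beta>, \<gamma>) \<in> cyclic_triples" "X \<in> R"
  shows "K \<beta> (K \<gamma> X) = K \<alpha> X" "K \<gamma> (K \<beta> X) = - K \<alpha> X"
proof -
  have "J \<alpha> p v = J \<beta> p (J \<gamma> p v) \<and> J \<alpha> p v = - J \<gamma> p (J \<beta> p v)"
    if "p \<in> points A" "v \<in> tangent_space A p" for p v
    using HG assms(1) that unfolding almost_HG_manifold_def cyclic_triples_def by blast
  then have "J \<beta> p (J \<gamma> p (X p)) = J \<alpha> p (X p)" "J \<gamma> p (J \<beta> p (X p)) = - J \<alpha> p (X p)"
    if "p \<in> points A" for p
    using rough_field_tangent[OF assms(2) that] that by (metis minus_minus)+
  then show "K \<beta> (K \<gamma> X) = K \<alpha> X" "K \<gamma> (K \<beta> X) = - K \<alpha> X"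
    by (auto simp: endo_app_def)
qed

section \<open>The averaged connection is a linear connection\<close>

text \<open>The sum of the four conjugates, not yet divided by 4. The minus signs appear because
  \<open>- K \<alpha>\<close> is the inverse of \<open>K \<alpha>\<close>.\<close>

definition conj_sum :: "'a connection" where
  "conj_sum Y Z = nabla Y Z - K 1 (nabla Y (K 1 Z)) - K 2 (nabla Y (K 2 Z)) - K 3 (nabla Y (K 3 Z))"

lemma conj_sum_cyclic:
  assumes "(\<alpha>, \<beta>, \<gamma>) \<in> cyclic_triples"
  shows "conj_sum Y Z =
    nabla Y Z - K \<alpha> (nabla Y (K \<alpha> Z)) - K \<beta> (nabla Y (K \<beta> Z)) - K \<gamma> (nabla Y (K \<gamma> Z))"
  using assms by (auto simp: cyclic_triples_def conj_sum_def)

text \<open>Stated for rough fields so that it applies to \<open>fscale u Z\<close> without a proof that products of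
  smooth functions are smooth.\<close>

lemma D_eq_average:
  assumes Z: "Z \<in> R" and odd: "nabla Y (- Z) = - nabla Y Z"
  shows "D Y Z = fscale (\<lambda>_. 1 / 4) (conj_sum Y Z)"
proof -
  have "cov_deriv_endo A nabla (J \<alpha>) Y (K \<alpha> Z) = - nabla Y Z - K \<alpha> (nabla Y (K \<alpha> Z))"
    if "\<alpha> \<in> {1, 2, 3}" for \<alpha>
    using K_square[OF that Z] odd
    by (simp add: cov_deriv_endo_def)
  \<comment> \<open>The three copies of \<open>- nabla Y Z\<close>, each weighted by 1/4, leave 1 -
    3/4 = 1/4 of \<open>nabla Y Z\<close>.\<close>
  then show ?thesis
    by (simp add: HG_connection_def conj_sum_def)
      (simp add: fscale_def tscale_def fun_eq_iff field_simps)
qed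

lemma D_eq_average_V: "Y \<in> V \<Longrightarrow> Z \<in> V \<Longrightarrow> D Y Z = fscale (\<lambda>_. 1 / 4) (conj_sum Y Z)"
  by (simp add: D_eq_average vector_field_rough nabla_uminus)

lemma conj_sum_V: "Y \<in> V \<Longrightarrow> Z \<in> V \<Longrightarrow> conj_sum Y Z \<in> V"
  by (simp add: conj_sum_def V_closed nabla_V)

lemma D_V: "Y \<in> V \<Longrightarrow> Z \<in> V \<Longrightarrow> D Y Z \<in> V"
  by (simp add: D_eq_average_V V_closed conj_sum_V)

text \<open>Each conjugate \<open>- K \<alpha> (nabla X (K \<alpha> (fscale u Y)))\<close> contributes one derivative term
  \<open>- K \<alpha> (fscale (deriv_along X u) (K \<alpha> Y)) = fscale (deriv_along X u) Y\<close>; with \<open>nabla\<close> itself these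
  make four.\<close>

lemma conj_sum_fscale_right:
  assumes X: "X \<in> V" and Y: "Y \<in> V" and u: "smooth_fun A u"
  shows "conj_sum X (fscale u Y) =
    fscale (\<lambda>_. 4) (fscale (deriv_along X u) Y) + fscale u (conj_sum X Y)"
proof -
  have "K \<alpha> (nabla X (K \<alpha> (fscale u Y))) =
      - fscale (deriv_along X u) Y + fscale u (K \<alpha> (nabla X (K \<alpha> Y)))" if \<alpha>: "\<alpha> \<in> {1, 2, 3}" for \<alpha>
  proof -
    have "nabla X (K \<alpha> (fscale u Y)) =
        fscale (deriv_along X u) (K \<alpha> Y) + fscale u (nabla X (K \<alpha> Y))"
      using \<alpha> X Y u by (simp add: K_linear R_closed nabla_fscale_right K_V del: insert_iff)
    then show ?thesis
      using \<alpha> X Y by (simp add: K_linear R_closed K_V nabla_V K_square del: insert_iff)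
        (simp add: uminus_eq_fscale fscale_commute)
  qed
  then show ?thesis
    by (simp add: conj_sum_def nabla_fscale_right[OF X Y u])
      (simp add: fscale_def tscale_def fun_eq_iff algebra_simps)
qed

lemma D_fscale_right:
  assumes X: "X \<in> V" and Y: "Y \<in> V" and u: "smooth_fun A u"
  shows "D X (fscale u Y) = fscale (deriv_along X u) Y + fscale u (D X Y)"
proof -
  \<comment> \<open>\<open>fscale u Y\<close> is not known to lie in \<open>V\<close>, so
    \<open>nabla_uminus\<close> does not apply to it. The sign is moved onto \<open>Y\<close> and
    the Leibniz rule is used there.\<close>
  have "nabla X (- fscale u Y) = nabla X (fscale u (- Y))"
    by (simp add: uminus_eq_fscale fscale_commute)
  also have "\<dots> = - nabla X (fscale u Y)"
    using X Y u by (simp add: nabla_fscale_right nabla_uminus V_closed)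
      (simp add: fscale_def tscale_def fun_eq_iff)
  finally have "D X (fscale u Y) = fscale (\<lambda>_. 1 / 4) (conj_sum X (fscale u Y))"
    using Y by (simp add: D_eq_average R_closed)
  then show ?thesis
    using X Y conj_sum_fscale_right[OF X Y u]
    by (simp add: D_eq_average_V) (simp add: fscale_def tscale_def fun_eq_iff algebra_simps)
qed

lemma conj_sum_add_left:
  assumes "X \<in> V" "Y \<in> V" "Z \<in> V"
  shows "conj_sum (X + Y) Z = conj_sum X Z + conj_sum Y Z"
  using assms by (simp add: conj_sum_def nabla_add_left K_linear R_closed V_closed nabla_V)

lemma conj_sum_add_right:
  assumes "X \<in> V" "Y \<in> V" "Z \<in> V"
  shows "conj_sum X (Y + Z) = conj_sum X Y + conj_sum X Z"
  using assms by (simp add: conj_sum_def nabla_add_right K_linear R_closed V_closed nabla_V)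

lemma conj_sum_fscale_left:
  assumes "X \<in> V" "Y \<in> V" "smooth_fun A u"
  shows "conj_sum (fscale u X) Y = fscale u (conj_sum X Y)"
  using assms
  by (simp add: conj_sum_def nabla_fscale_left K_linear R_closed V_closed nabla_V fscale_diff)

lemma D_fscale_left:
  assumes "X \<in> V" "Y \<in> V" "smooth_fun A u"
  shows "D (fscale u X) Y = fscale u (D X Y)"
proof -
  \<comment> \<open>Now the direction \<open>fscale u X\<close> is not known to lie in
    \<open>V\<close>; oddness is obtained by pulling \<open>u\<close> out first.\<close>
  have "nabla (fscale u X) (- Y) = - nabla (fscale u X) Y"
    using assms by (simp add: nabla_fscale_left nabla_uminus V_closed)
      (simp add: fscale_def tscale_def fun_eq_iff)
  then show ?thesis
    using assms by (simp add: D_eq_average vector_field_rough nabla_uminus conj_sum_fscale_left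
        fscale_commute)
qed

lemma D_linear_connection: "linear_connection A D"
  unfolding linear_connection_def
  \<comment> \<open>First closure and the two scaling rules, whose arguments may lie outside
    \<open>V\<close>; then additivity, by passing to \<open>conj_sum\<close>.\<close>
  by (simp add: D_V D_fscale_left D_fscale_right)
    (simp add: D_eq_average_V V_closed conj_sum_add_left conj_sum_add_right fscale_add)

section \<open>The averaged connection commutes with the almost complex structures\<close>

text \<open>On the left \<open>K \<alpha>\<close> is absorbed inside \<open>nabla\<close>, on the
  right outside it. Either way the plain term trades places with the \<alpha> term and the \<beta>
  term with the \<gamma> term, up to sign, so both sides reduce to the same four terms.\<close>

lemma conj_sum_K:
  assumes c: "(\<alpha>, \<beta>, \<gamma>) \<in> cyclic_triples" and Y: "Y \<in> V" and Z: "Z \<in> V"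
  shows "conj_sum Y (K \<alpha> Z) = K \<alpha> (conj_sum Y Z)"
proof -
  note c' = rotate[OF c] and c'' = rotate[OF rotate[OF c]]
  note ix = cyclic_mem[OF c] cyclic_mem[OF c'] cyclic_mem[OF c'']
  note NV = nabla_V[OF Y]
  have R: "W \<in> R" "nabla Y W \<in> R" "nabla Y (- W) = - nabla Y W" if "W \<in> V" for W
    using that vector_field_rough NV nabla_uminus[OF Y] by blast+
  have KV: "K \<alpha> Z \<in> V" "K \<beta> Z \<in> V" "K \<gamma> Z \<in> V"
    using ix Z K_V by blast+
  have KR: "K \<alpha> (nabla Y W) \<in> R" "K \<beta> (nabla Y W) \<in> R" "K \<gamma> (nabla Y W) \<in> R" if "W \<in> V" for W
    using ix R(2)[OF that] K_R by blast+
  have "conj_sum Y (K \<alpha> Z) =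
      nabla Y (K \<alpha> Z) + K \<alpha> (nabla Y Z) + K \<beta> (nabla Y (K \<gamma> Z)) - K \<gamma> (nabla Y (K \<beta> Z))"
    unfolding conj_sum_cyclic[OF c] K_square[OF ix(1) R(1)[OF Z]]
      K_cyclic(2)[OF c'' R(1)[OF Z]] K_cyclic(1)[OF c' R(1)[OF Z]]
      R(3)[OF Z] R(3)[OF KV(3)]
      endo_app_uminus[OF J_smooth[OF ix(1)] R(2)[OF Z]]
      endo_app_uminus[OF J_smooth[OF ix(2)] R(2)[OF KV(3)]]
    by (simp add: algebra_simps)
  \<comment> \<open>Each term is rewritten with \<open>K \<alpha>\<close> in front, reading the
    products outside \<open>nabla\<close> backwards.\<close>
  also have "\<dots> = K \<alpha> (nabla Y Z) - K \<alpha> (K \<alpha> (nabla Y (K \<alpha> Z))) -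
      K \<alpha> (K \<beta> (nabla Y (K \<beta> Z))) - K \<alpha> (K \<gamma> (nabla Y (K \<gamma> Z)))"
    unfolding K_square[OF ix(1) R(2)[OF KV(1)]] K_cyclic(1)[OF c'' R(2)[OF KV(2)]]
      K_cyclic(2)[OF c' R(2)[OF KV(3)]]
    by (simp add: algebra_simps)
  also have "\<dots> = K \<alpha> (conj_sum Y Z)"
    unfolding conj_sum_cyclic[OF c] using Z KV
    by (simp add: endo_app_diff[OF J_smooth[OF ix(1)]] R KR rough_fields_diff)
  finally show ?thesis .
qed

lemma D_K:
  assumes "\<alpha> \<in> {1, 2, 3}" and Y: "Y \<in> V" and Z: "Z \<in> V"
  shows "D Y (K \<alpha> Z) = K \<alpha> (D Y Z)"
proof -
  obtain \<beta> \<gamma> where "(\<alpha>, \<beta>, \<gamma>) \<in> cyclic_triples"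
    using assms(1) by (auto simp: cyclic_triples_def)
  from conj_sum_K[OF this Y Z] show ?thesis
    using K_V[OF assms(1) Z] Y Z endo_app_fscale[OF J_smooth[OF assms(1)]]
    by (simp add: D_eq_average_V conj_sum_V vector_field_rough)
qed

lemma D_parallel_J:
  assumes "\<alpha> \<in> {1, 2, 3}"
  shows "parallel_endo A D (J \<alpha>)"
  using D_K[OF assms] by (simp add: parallel_endo_def cov_deriv_endo_def)

section \<open>Compatibility with the metric and its associated forms\<close>

lemma nabla_metric:
  assumes "Y \<in> V" "X \<in> V" "Z \<in> V" "p \<in> points A"
  shows "deriv_along Y (bilin_app g X Z) p =
    bilin_app g (nabla Y X) Z p + bilin_app g X (nabla Y Z) p"
  using LC assms by (simp add: levi_civita_connection_def parallel_bilin_def cov_deriv_bilin_def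
      diff_diff_eq)

lemma eps_square: "eps \<alpha> * eps \<alpha> = 1"
  by (simp add: eps_def)

lemma g_K_K:
  assumes "\<alpha> \<in> {1, 2, 3}" "X \<in> R" "Z \<in> R" "p \<in> points A"
  shows "bilin_app g X Z p = eps \<alpha> * bilin_app g (K \<alpha> X) (K \<alpha> Z) p"
proof -
  have "g p v w = eps \<alpha> * g p (J \<alpha> p v) (J \<alpha> p w)"
    if "v \<in> tangent_space A p" "w \<in> tangent_space A p" for v w
    using HG assms(1,4) that unfolding almost_HG_manifold_def by blast
  from this[OF rough_field_tangent[OF assms(2,4)] rough_field_tangent[OF assms(3,4)]]
  show ?thesis using assms(4) by (simp add: bilin_app_def endo_app_def)
qed

text \<open>Put \<open>K \<alpha> Z\<close> for \<open>Z\<close>, or \<open>K \<alpha> X\<close> for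
  \<open>X\<close>, in \<open>g_K_K\<close>: the square of \<open>K \<alpha>\<close> gives the minus
  sign, and \<open>eps_square\<close> moves the factor across.\<close>

lemma g_K_left:
  assumes a: "\<alpha> \<in> {1, 2, 3}" and X: "X \<in> R" and Z: "Z \<in> R" and p: "p \<in> points A"
  shows "eps \<alpha> * bilin_app g X (K \<alpha> Z) p = - bilin_app g (K \<alpha> X) Z p"
    and "eps \<alpha> * bilin_app g (K \<alpha> X) Z p = - bilin_app g X (K \<alpha> Z) p"
  using g_K_K[OF a X K_R[OF a Z] p] g_K_K[OF a K_R[OF a X] Z p]
    K_square[OF a X] K_square[OF a Z] bilin_app_uminus[OF g_smooth _ _ p] X Z K_R[OF a X] K_R[OF a Z]
    eps_square[of \<alpha>]
  by (simp_all add: mult.assoc[symmetric])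

text \<open>The conjugate of \<open>nabla\<close> by \<open>K \<alpha>\<close> is metric:
  \<open>g_K_K\<close> replaces both arguments by their images, \<open>nabla_metric\<close>
  differentiates, and \<open>g_K_left\<close> moves the remaining \<open>K \<alpha>\<close> across
  \<open>g\<close>. The two occurrences of \<open>eps \<alpha>\<close> are absorbed there, so
  isometries and anti-isometries are treated alike.\<close>

lemma nabla_conj_metric:
  assumes a: "\<alpha> \<in> {1, 2, 3}" and Y: "Y \<in> V" and X: "X \<in> V" and Z: "Z \<in> V" and p: "p \<in> points A"
  shows "deriv_along Y (bilin_app g X Z) p =
    - bilin_app g (K \<alpha> (nabla Y (K \<alpha> X))) Z p - bilin_app g X (K \<alpha> (nabla Y (K \<alpha> Z))) p"
proof -
  note KX = K_V[OF a X] and KZ = K_V[OF a Z]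
  have sm: "smooth_fun A (bilin_app g (K \<alpha> X) (K \<alpha> Z))"
    using g_smooth KX KZ unfolding smooth_bilin_field_def by blast
  have "deriv_along Y (bilin_app g X Z) p =
      deriv_along Y (\<lambda>q. eps \<alpha> * bilin_app g (K \<alpha> X) (K \<alpha> Z) q) p"
    by (intro deriv_along_cong[OF manifold Y p] g_K_K a vector_field_rough X Z)
  also have "\<dots> = eps \<alpha> * deriv_along Y (bilin_app g (K \<alpha> X) (K \<alpha> Z)) p"
    by (rule deriv_along_cmult[OF Y p sm])
  also have "\<dots> = eps \<alpha> * bilin_app g (nabla Y (K \<alpha> X)) (K \<alpha> Z) p +
      eps \<alpha> * bilin_app g (K \<alpha> X) (nabla Y (K \<alpha> Z)) p"
    by (simp only: nabla_metric[OF Y KX KZ p] distrib_left)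
  also have "\<dots> =
      - bilin_app g (K \<alpha> (nabla Y (K \<alpha> X))) Z p - bilin_app g X (K \<alpha> (nabla Y (K \<alpha> Z))) p"
    using g_K_left(1)[OF a vector_field_rough[OF nabla_V[OF Y KX]] vector_field_rough[OF Z] p]
      g_K_left(2)[OF a vector_field_rough[OF X] vector_field_rough[OF nabla_V[OF Y KZ]] p]
    by simp
  finally show ?thesis .
qed

lemma D_metric:
  assumes Y: "Y \<in> V" and X: "X \<in> V" and Z: "Z \<in> V" and p: "p \<in> points A"
  shows "deriv_along Y (bilin_app g X Z) p = bilin_app g (D Y X) Z p + bilin_app g X (D Y Z) p"
proof -
  have "bilin_app g (conj_sum Y W) W' p = bilin_app g (nabla Y W) W' p -
      bilin_app g (K 1 (nabla Y (K 1 W))) W' p - bilin_app g (K 2 (nabla Y (K 2 W))) W' p -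
      bilin_app g (K 3 (nabla Y (K 3 W))) W' p"
    "bilin_app g W' (conj_sum Y W) p = bilin_app g W' (nabla Y W) p -
      bilin_app g W' (K 1 (nabla Y (K 1 W))) p - bilin_app g W' (K 2 (nabla Y (K 2 W))) p -
      bilin_app g W' (K 3 (nabla Y (K 3 W))) p"
    if "W \<in> V" "W' \<in> V" for W W'
    using that Y p
    by (simp_all add: conj_sum_def bilin_app_diff[OF g_smooth] R_closed V_closed nabla_V)
  \<comment> \<open>Each of the four metric connections contributes the derivative once, hence the
    factor 4.\<close>
  then have "bilin_app g (conj_sum Y X) Z p + bilin_app g X (conj_sum Y Z) p =
      4 * deriv_along Y (bilin_app g X Z) p"
    using nabla_metric[OF Y X Z p] nabla_conj_metric[OF _ Y X Z p, of 1]
      nabla_conj_metric[OF _ Y X Z p, of 2] nabla_conj_metric[OF _ Y X Z p, of 3] X Z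
    by simp
  then show ?thesis
    using Y X Z p by (simp add: D_eq_average_V bilin_app_fscale[OF g_smooth] vector_field_rough
        conj_sum_V)
qed

lemma D_parallel_g: "parallel_bilin A D g"
  by (simp add: parallel_bilin_def cov_deriv_bilin_def D_metric)

text \<open>On the manifold the form is \<open>g\<close> with \<open>K \<alpha>\<close> applied to
  its first argument, so metricity of \<open>D\<close> at \<open>K \<alpha> X\<close> combines with
  \<open>D_K\<close>.\<close>

lemma D_parallel_assoc_form:
  assumes a: "\<alpha> \<in> {1, 2, 3}"
  shows "parallel_bilin A D (assoc_form g (J \<alpha>))"
proof -
  have eq: "bilin_app (assoc_form g (J \<alpha>)) X Z p = bilin_app g (K \<alpha> X) Z p"
    if "p \<in> points A" for X Z p
    using that by (simp add: bilin_app_def assoc_form_def endo_app_def)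
  have "deriv_along Y (bilin_app (assoc_form g (J \<alpha>)) X Z) p =
      deriv_along Y (bilin_app g (K \<alpha> X) Z) p" if "Y \<in> V" "p \<in> points A" for X Y Z p
    using that by (intro deriv_along_cong[OF manifold] eq)
  then show ?thesis
    using D_metric K_V[OF a] D_K[OF a]
    by (simp add: parallel_bilin_def cov_deriv_bilin_def eq)
qed

end

theorem proposition7:
  fixes n :: nat
    and T :: "'a topology"
    and A :: "('a, 'e::euclidean_space) atlas"
    and J :: "nat \<Rightarrow> 'a endo_field"
    and g :: "'a bilin_field"
    and nabla D :: "'a connection"
  assumes "almost_HG_manifold n T A J g"
    and "levi_civita_connection A g nabla"
    and "D = HG_connection A J nabla"
  shows "linear_connection A D \<and>
         (\<forall>\<alpha>\<in>{1, 2, 3}. parallel_endo A D (J \<alpha>)) \<and>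
         parallel_bilin A D g \<and>
         (\<forall>\<alpha>\<in>{1, 2, 3}. parallel_bilin A D (assoc_form g (J \<alpha>)))"
proof -
  interpret almost_HG_connection n T A J g nabla
    using assms(1,2) by unfold_locales
  show ?thesis
    unfolding assms(3)
    using D_linear_connection D_parallel_J D_parallel_g D_parallel_assoc_form by blast
qed

end
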